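(* Let $\mathcal{K}=(K,\leq,D,\Vdash)$ be a semi-narrow Kripke model with tree frame for a first-order language $\mathcal{L}$, and let $\alpha\in K$. Then there exists $\rho\in{\sf PEM}_{\sf sen}(\mathcal{L}(D(\alpha)))^*$ such that for all sentences $A$ of $\mathcal{L}(D(\alpha))$, $$\alpha\Vdash (A^\forall)^\rho\quad\text{iff}\quad\alpha\models A.$$
   Context: A Kripke model for $\mathcal{L}$ is $\mathcal{K}=(K,\leq,D,\Vdash)$ with $(K,\leq)$ a nonempty poset, nonempty domains $D(\alpha)$ increasing along $\leq$, and $\Vdash$ a monotone relation between nodes $\alpha$ and atomic sentences of $\mathcal{L}(D(\alpha))$, extended to all sentences in the standard intuitionistic way. $\alpha\models A$ means $A$ is true in the classical structure with universe $D(\alpha)$ in which an atomic sentence holds iff forced at $\alpha$. Tree frame: $(K,\leq)$ is a tree. For $\beta\in K$, $d(\beta)$ is the depth of the submodel of nodes $\geq\beta$, i.e. the maximum $n$ such that no chain of nodes $\geq\beta$ is longer than $n$ (possibly infinite). $\mathcal{K}$ is semi-narrow if for every set $X$ of pairwise incomparable nodes there is $n$ such that $d(u)\leq n$ for all but finitely many $u\in X$. For a sentence $\rho$, $A^\rho$ (Friedman translation) replaces every atomic subformula $P$ (including $\bot$) by $P\vee\rho$, commuting with $\wedge,\vee,\to,\forall,\exists$; $\neg A:=A\to\bot$. $A^\forall$ is obtained from $A$ by replacing every subformula $\forall xB$ by $\forall x\neg\neg B$. ${\sf PEM}_{\sf sen}(\mathcal{L}')$ is the set of sentences $A\vee\neg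 A$ with $A$ a sentence of $\mathcal{L}'$. For a set $\Gamma$, $\Gamma^*=\bigcup_n\Gamma^n$ with $\Gamma^0=\{\bot\}$, $\Gamma^{n+1}=\{A^B:A\in\Gamma^n,B\in\Gamma\}$. *)

theory Defs
  imports Main "HOL-Library.Extended_Nat"
begin

section \<open>First-order languages with parameters\<close>

record ('f, 'p) lang =
  fun_syms :: "'f set"
  fun_arity :: "'f \<Rightarrow> nat"
  rel_syms :: "'p set"
  rel_arity :: "'p \<Rightarrow> nat"

text \<open>\<open>Par d\<close> is the name of the domain element \<open>d\<close>; constants of the language are function symbols
  of arity 0.\<close>

datatype (tm_funs: 'f, tm_pars: 'd) tm =
  Var nat | Par 'd | Fun 'f "('f, 'd) tm list"

datatype (fm_funs: 'f, fm_rels: 'p, fm_pars: 'd) fm =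
    Bot
  | Atom 'p "('f, 'd) tm list"
  | Conj "('f, 'p, 'd) fm" "('f, 'p, 'd) fm"
  | Disj "('f, 'p, 'd) fm" "('f, 'p, 'd) fm"
  | Imp "('f, 'p, 'd) fm" "('f, 'p, 'd) fm"
  | All nat "('f, 'p, 'd) fm"
  | Ex nat "('f, 'p, 'd) fm"

abbreviation Neg :: "('f, 'p, 'd) fm \<Rightarrow> ('f, 'p, 'd) fm" where
  "Neg A \<equiv> Imp A Bot"

primrec tm_vars :: "('f, 'd) tm \<Rightarrow> nat set" where
  "tm_vars (Var x) = {x}"
| "tm_vars (Par d) = {}"
| "tm_vars (Fun f ts) = \<Union> (set (map tm_vars ts))"

primrec free_vars :: "('f, 'p, 'd) fm \<Rightarrow> nat set" where
  "free_vars Bot = {}"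
| "free_vars (Atom P ts) = \<Union> (set (map tm_vars ts))"
| "free_vars (Conj A B) = free_vars A \<union> free_vars B"
| "free_vars (Disj A B) = free_vars A \<union> free_vars B"
| "free_vars (Imp A B) = free_vars A \<union> free_vars B"
| "free_vars (All x A) = free_vars A - {x}"
| "free_vars (Ex x A) = free_vars A - {x}"

fun wf_tm :: "('f, 'p) lang \<Rightarrow> ('f, 'd) tm \<Rightarrow> bool" where
  "wf_tm L (Var x) = True"
| "wf_tm L (Par d) = True"
| "wf_tm L (Fun f ts) =
    (f \<in> fun_syms L \<and> length ts = fun_arity L f \<and> (\<forall>t \<in> set ts. wf_tm L t))"

primrec wf_fm :: "('f, 'p) lang \<Rightarrow> ('f, 'p, 'd) fm \<Rightarrow> bool" where
  "wf_fm L Bot = True"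
| "wf_fm L (Atom P ts) =
    (P \<in> rel_syms L \<and> length ts = rel_arity L P \<and> (\<forall>t \<in> set ts. wf_tm L t))"
| "wf_fm L (Conj A B) = (wf_fm L A \<and> wf_fm L B)"
| "wf_fm L (Disj A B) = (wf_fm L A \<and> wf_fm L B)"
| "wf_fm L (Imp A B) = (wf_fm L A \<and> wf_fm L B)"
| "wf_fm L (All x A) = wf_fm L A"
| "wf_fm L (Ex x A) = wf_fm L A"

definition sentences :: "('f, 'p) lang \<Rightarrow> 'd set \<Rightarrow> ('f, 'p, 'd) fm set" where
  "sentences L X = {A. wf_fm L A \<and> free_vars A = {} \<and> fm_pars A \<subseteq> X}"

primrec subst_tm :: "nat \<Rightarrow> 'd \<Rightarrow> ('f, 'd) tm \<Rightarrow> ('f, 'd) tm" where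
  "subst_tm x d (Var y) = (if y = x then Par d else Var y)"
| "subst_tm x d (Par e) = Par e"
| "subst_tm x d (Fun f ts) = Fun f (map (subst_tm x d) ts)"

primrec subst :: "nat \<Rightarrow> 'd \<Rightarrow> ('f, 'p, 'd) fm \<Rightarrow> ('f, 'p, 'd) fm" where
  "subst x d Bot = Bot"
| "subst x d (Atom P ts) = Atom P (map (subst_tm x d) ts)"
| "subst x d (Conj A B) = Conj (subst x d A) (subst x d B)"
| "subst x d (Disj A B) = Disj (subst x d A) (subst x d B)"
| "subst x d (Imp A B) = Imp (subst x d A) (subst x d B)"
| "subst x d (All y A) = All y (if y = x then A else subst x d A)"
| "subst x d (Ex y A) = Ex y (if y = x then A else subst x d A)"

primrec height :: "('f, 'p, 'd) fm \<Rightarrow> nat" where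
  "height Bot = 0"
| "height (Atom P ts) = 0"
| "height (Conj A B) = Suc (max (height A) (height B))"
| "height (Disj A B) = Suc (max (height A) (height B))"
| "height (Imp A B) = Suc (max (height A) (height B))"
| "height (All x A) = Suc (height A)"
| "height (Ex x A) = Suc (height A)"

lemma height_subst [simp]: "height (subst x d A) = height A"
  by (induction A) auto

section \<open>Classical structures\<close>

record ('f, 'p, 'd) struct =
  universe :: "'d set"
  fun_interp :: "'f \<Rightarrow> 'd list \<Rightarrow> 'd"
  rel_interp :: "'p \<Rightarrow> 'd list \<Rightarrow> bool"

definition is_struct :: "('f, 'p) lang \<Rightarrow> ('f, 'p, 'd) struct \<Rightarrow> bool" where
  "is_struct L S \<longleftrightarrow> universe S \<noteq> {} \<and>
    (\<forall>f \<in> fun_syms L. \<forall>ds. length ds = fun_arity L f \<and> set ds \<subseteq> universe S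
        \<longrightarrow> fun_interp S f ds \<in> universe S)"

text \<open>Only closed terms are ever evaluated, so the value of a variable is irrelevant.\<close>

primrec tm_val :: "('f, 'p, 'd) struct \<Rightarrow> ('f, 'd) tm \<Rightarrow> 'd" where
  "tm_val S (Var x) = undefined"
| "tm_val S (Par d) = d"
| "tm_val S (Fun f ts) = fun_interp S f (map (tm_val S) ts)"

function satisfies :: "('f, 'p, 'd) struct \<Rightarrow> ('f, 'p, 'd) fm \<Rightarrow> bool" where
  "satisfies S Bot = False"
| "satisfies S (Atom P ts) = rel_interp S P (map (tm_val S) ts)"
| "satisfies S (Conj A B) = (satisfies S A \<and> satisfies S B)"
| "satisfies S (Disj A B) = (satisfies S A \<or> satisfies S B)"
| "satisfies S (Imp A B) = (satisfies S A \<longrightarrow> satisfies S B)"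
| "satisfies S (All x A) = (\<forall>d \<in> universe S. satisfies S (subst x d A))"
| "satisfies S (Ex x A) = (\<exists>d \<in> universe S. satisfies S (subst x d A))"
  by pat_completeness auto
termination
  by (relation "measure (\<lambda>(S, A). height A)") auto

section \<open>Kripke models\<close>

text \<open>The node \<open>u\<close> carries the classical structure \<open>str M u\<close>: its universe is the domain of \<open>u\<close>, and
  the atomic sentences forced at \<open>u\<close> are those true in it. Monotonicity is required of the atomic
  sentences themselves, so compound terms may change their value along the order as long as atomic
  truth is preserved; this includes the case where function interpretations extend each other, and
  equality read as a congruence (it is then one of the relation symbols).\<close>

record ('k, 'f, 'p, 'd) kripke =
  nodes :: "'k set"
  le :: "'k rel"
  str :: "'k \<Rightarrow> ('f, 'p, 'd) struct"

abbreviation node_dom :: "('k, 'f, 'p, 'd) kripke \<Rightarrow> 'k \<Rightarrow> 'd set" where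
  "node_dom M u \<equiv> universe (str M u)"

function forces :: "('k, 'f, 'p, 'd) kripke \<Rightarrow> 'k \<Rightarrow> ('f, 'p, 'd) fm \<Rightarrow> bool" where
  "forces M u Bot = False"
| "forces M u (Atom P ts) = rel_interp (str M u) P (map (tm_val (str M u)) ts)"
| "forces M u (Conj A B) = (forces M u A \<and> forces M u B)"
| "forces M u (Disj A B) = (forces M u A \<or> forces M u B)"
| "forces M u (Imp A B) = (\<forall>v. (u, v) \<in> le M \<longrightarrow> forces M v A \<longrightarrow> forces M v B)"
| "forces M u (All x A) =
    (\<forall>v. (u, v) \<in> le M \<longrightarrow> (\<forall>d \<in> node_dom M v. forces M v (subst x d A)))"
| "forces M u (Ex x A) = (\<exists>d \<in> node_dom M u. forces M u (subst x d A))"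
  by pat_completeness auto
termination
  by (relation "measure (\<lambda>(M, u, A). height A)") auto

definition kripke_model :: "('f, 'p) lang \<Rightarrow> ('k, 'f, 'p, 'd) kripke \<Rightarrow> bool" where
  "kripke_model L M \<longleftrightarrow>
    nodes M \<noteq> {} \<and> partial_order_on (nodes M) (le M) \<and>
    (\<forall>u \<in> nodes M. is_struct L (str M u)) \<and>
    (\<forall>u v. (u, v) \<in> le M \<longrightarrow> node_dom M u \<subseteq> node_dom M v) \<and>
    (\<forall>u v P ts. (u, v) \<in> le M \<longrightarrow> Atom P ts \<in> sentences L (node_dom M u) \<longrightarrow>
        forces M u (Atom P ts) \<longrightarrow> forces M v (Atom P ts))"

text \<open>A tree is a partial order in which the strict predecessors of every node are well-ordered.
  This covers the trees with finite linearly ordered sets of predecessors, with or without a root.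
  Mere linearity of the sets of predecessors would not be enough.\<close>

definition tree_frame :: "('k, 'f, 'p, 'd) kripke \<Rightarrow> bool" where
  "tree_frame M \<longleftrightarrow>
    (\<forall>u \<in> nodes M. well_order_on (underS (le M) u) (Restr (le M) (underS (le M) u)))"

text \<open>The supremum of the lengths of finite chains: it is \<open>\<infinity>\<close> iff there are arbitrarily long finite
  chains, in particular if there is an infinite one.\<close>

definition depth :: "('k, 'f, 'p, 'd) kripke \<Rightarrow> 'k \<Rightarrow> enat" where
  "depth M u = (SUP C \<in> {C \<in> Chains (le M). finite C \<and> C \<subseteq> above (le M) u}. enat (card C))"

definition semi_narrow :: "('k, 'f, 'p, 'd) kripke \<Rightarrow> bool" where
  "semi_narrow M \<longleftrightarrow>
    (\<forall>X \<subseteq> nodes M. pairwise (\<lambda>u v. (u, v) \<notin> le M \<and> (v, u) \<notin> le M) X \<longrightarrow>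
      (\<exists>n :: nat. finite {u \<in> X. \<not> depth M u \<le> enat n}))"

section \<open>Translations\<close>

text \<open>\<open>friedman \<rho> A\<close> is $A^\rho$; it is only used for sentences \<open>\<rho>\<close>, so no variable is captured.\<close>

primrec friedman :: "('f, 'p, 'd) fm \<Rightarrow> ('f, 'p, 'd) fm \<Rightarrow> ('f, 'p, 'd) fm" where
  "friedman \<rho> Bot = Disj Bot \<rho>"
| "friedman \<rho> (Atom P ts) = Disj (Atom P ts) \<rho>"
| "friedman \<rho> (Conj A B) = Conj (friedman \<rho> A) (friedman \<rho> B)"
| "friedman \<rho> (Disj A B) = Disj (friedman \<rho> A) (friedman \<rho> B)"
| "friedman \<rho> (Imp A B) = Imp (friedman \<rho> A) (friedman \<rho> B)"
| "friedman \<rho> (All x A) = All x (friedman \<rho> A)"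
| "friedman \<rho> (Ex x A) = Ex x (friedman \<rho> A)"

primrec forall_trans :: "('f, 'p, 'd) fm \<Rightarrow> ('f, 'p, 'd) fm" where
  "forall_trans Bot = Bot"
| "forall_trans (Atom P ts) = Atom P ts"
| "forall_trans (Conj A B) = Conj (forall_trans A) (forall_trans B)"
| "forall_trans (Disj A B) = Disj (forall_trans A) (forall_trans B)"
| "forall_trans (Imp A B) = Imp (forall_trans A) (forall_trans B)"
| "forall_trans (All x A) = All x (Neg (Neg (forall_trans A)))"
| "forall_trans (Ex x A) = Ex x (forall_trans A)"

definition PEM_sen :: "('f, 'p) lang \<Rightarrow> 'd set \<Rightarrow> ('f, 'p, 'd) fm set" where
  "PEM_sen L X = {Disj A (Neg A) | A. A \<in> sentences L X}"

primrec friedman_pow :: "('f, 'p, 'd) fm set \<Rightarrow> nat \<Rightarrow> ('f, 'p, 'd) fm set" where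
  "friedman_pow \<Gamma> 0 = {Bot}"
| "friedman_pow \<Gamma> (Suc n) = {friedman B A | A B. A \<in> friedman_pow \<Gamma> n \<and> B \<in> \<Gamma>}"

definition friedman_star :: "('f, 'p, 'd) fm set \<Rightarrow> ('f, 'p, 'd) fm set" where
  "friedman_star \<Gamma> = (\<Union>n. friedman_pow \<Gamma> n)"

end

theory Submission
  imports Defs
begin

text \<open>Passing from \<open>A\<close> to \<open>A\<^sup>\<rho>\<close> amounts to forcing \<open>A\<close> in the submodel of the nodes that do not force
  \<open>\<rho>\<close>, and \<open>\<Gamma>\<^sup>*\<close> codes the finite iterations of this pruning by members of \<open>\<Gamma>\<close>. Prune the cone above \<open>\<alpha>\<close>
  by instances of excluded middle that \<open>\<alpha>\<close> does not force as long as there are any. Every surviving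
  node sees a node that has just been removed, which by semi-narrowness and the well-foundedness of
  the tree cannot go on forever. When the process stops, \<open>\<alpha>\<close> decides every sentence over its domain, and
  then forcing \<open>A\<^sup>\<forall>\<close> at \<open>\<alpha>\<close> is classical truth of \<open>A\<close>.\<close>

section \<open>Substitution, sentences and the two translations\<close>

lemma tm_vars_subst_tm [simp]: "tm_vars (subst_tm x d t) = tm_vars t - {x}"
  by (induction t) auto

lemma free_vars_subst [simp]: "free_vars (subst x d A) = free_vars A - {x}"
  by (induction A) auto

lemma wf_tm_subst_tm [simp]: "wf_tm L (subst_tm x d t) = wf_tm L t"
  by (induction t) auto

lemma wf_fm_subst [simp]: "wf_fm L (subst x d A) = wf_fm L A"
  by (induction A) auto

lemma tm_pars_subst_tm: "tm_pars (subst_tm x d t) \<subseteq> insert d (tm_pars t)"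
  by (induction t) auto

lemma fm_pars_subst: "fm_pars (subst x d A) \<subseteq> insert d (fm_pars A)"
  by (induction A) (auto dest!: subsetD[OF tm_pars_subst_tm])

lemma subst_tm_fresh: "x \<notin> tm_vars t \<Longrightarrow> subst_tm x d t = t"
  by (induction t) (auto intro: map_idI)

lemma subst_fresh: "x \<notin> free_vars A \<Longrightarrow> subst x d A = A"
  by (induction A) (auto intro!: map_idI subst_tm_fresh)

lemma sentences_mono: "A \<in> sentences L X \<Longrightarrow> X \<subseteq> Y \<Longrightarrow> A \<in> sentences L Y"
  by (auto simp: sentences_def)

lemma sentences_subst:
  assumes "wf_fm L A" "free_vars A \<subseteq> {x}" "fm_pars A \<subseteq> X" "d \<in> X"
  shows "subst x d A \<in> sentences L X"
  using assms fm_pars_subst[of x d A] by (auto simp: sentences_def)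

lemma subst_friedman:
  "free_vars \<rho> = {} \<Longrightarrow> subst x d (friedman \<rho> A) = friedman \<rho> (subst x d A)"
  by (induction A) (auto simp: subst_fresh)

lemma friedman_sentence:
  assumes "A \<in> sentences L X" "\<rho> \<in> sentences L X"
  shows "friedman \<rho> A \<in> sentences L X"
proof -
  have "wf_fm L A \<Longrightarrow> wf_fm L (friedman \<rho> A)" "free_vars (friedman \<rho> A) = free_vars A"
    "fm_pars A \<subseteq> X \<Longrightarrow> fm_pars (friedman \<rho> A) \<subseteq> X"
    using assms(2) by (induction A) (auto simp: sentences_def)
  then show ?thesis using assms(1) by (simp add: sentences_def)
qed

lemma forall_trans_subst [simp]:
  "forall_trans (subst x d A) = subst x d (forall_trans A)"
  by (induction A) auto

lemma wf_fm_forall_trans [simp]: "wf_fm L (forall_trans A) = wf_fm L A"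
  by (induction A) auto

lemma free_vars_forall_trans [simp]: "free_vars (forall_trans A) = free_vars A"
  by (induction A) auto

lemma fm_pars_forall_trans [simp]: "fm_pars (forall_trans A) = fm_pars A"
  by (induction A) auto

lemma forall_trans_sentence: "A \<in> sentences L X \<Longrightarrow> forall_trans A \<in> sentences L X"
  by (simp add: sentences_def)

lemma PEM_sen_sentences: "PEM_sen L X \<subseteq> sentences L X"
  by (auto simp: PEM_sen_def sentences_def)

lemma friedman_pow_sentences:
  "\<rho> \<in> friedman_pow \<Gamma> n \<Longrightarrow> \<Gamma> \<subseteq> sentences L X \<Longrightarrow> \<rho> \<in> sentences L X"
  by (induction n arbitrary: \<rho>) (auto intro!: friedman_sentence, auto simp: sentences_def)

section \<open>Frames and persistence of forcing\<close>

text \<open>Unlike a Kripke model, a frame over \<open>X\<close> may be empty, so that the class is closed under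
  removing the nodes that force a given sentence.\<close>

definition frame_over :: "('f, 'p) lang \<Rightarrow> 'd set \<Rightarrow> ('k, 'f, 'p, 'd) kripke \<Rightarrow> bool" where
  "frame_over L X N \<longleftrightarrow>
    partial_order_on (nodes N) (le N) \<and>
    (\<forall>u \<in> nodes N. is_struct L (str N u) \<and> X \<subseteq> node_dom N u) \<and>
    (\<forall>u v. (u, v) \<in> le N \<longrightarrow> node_dom N u \<subseteq> node_dom N v) \<and>
    (\<forall>u v P ts. (u, v) \<in> le N \<longrightarrow> Atom P ts \<in> sentences L (node_dom N u) \<longrightarrow>
        forces N u (Atom P ts) \<longrightarrow> forces N v (Atom P ts))"

lemma frame_over_le_nodes: "frame_over L X N \<Longrightarrow> (u, v) \<in> le N \<Longrightarrow> u \<in> nodes N \<and> v \<in> nodes N"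
  by (auto simp: frame_over_def partial_order_on_def preorder_on_def)

lemma frame_over_refl: "frame_over L X N \<Longrightarrow> u \<in> nodes N \<Longrightarrow> (u, u) \<in> le N"
  by (auto simp: frame_over_def partial_order_on_def preorder_on_def refl_on_def)

lemma frame_over_trans: "frame_over L X N \<Longrightarrow> (u, v) \<in> le N \<Longrightarrow> (v, w) \<in> le N \<Longrightarrow> (u, w) \<in> le N"
  by (auto simp: frame_over_def partial_order_on_def preorder_on_def elim: transE)

lemma frame_over_dom_ne: "frame_over L X N \<Longrightarrow> u \<in> nodes N \<Longrightarrow> node_dom N u \<noteq> {}"
  by (auto simp: frame_over_def is_struct_def)

lemma frame_over_sentence:
  assumes "frame_over L X N" "u \<in> nodes N" "A \<in> sentences L X"
  shows "A \<in> sentences L (node_dom N u)"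
  using assms(1,2) by (intro sentences_mono[OF assms(3)]) (simp add: frame_over_def)

text \<open>Induction is on \<open>height\<close>, since the existential case passes to
  \<open>subst x d B\<close>. Implications and universal formulas persist by transitivity. The
  restriction to sentences over the domain of \<open>u\<close> comes from the atoms, whose
  persistence is assumed only for those.\<close>

lemma forces_mono:
  assumes "frame_over L X N" "(u, v) \<in> le N" "A \<in> sentences L (node_dom N u)" "forces N u A"
  shows "forces N v A"
  using assms(2-)
proof (induction "height A" arbitrary: A u v rule: less_induct)
  case less
  note trans = frame_over_trans[OF assms(1)]
  show ?case
  proof (cases A)
    case (Atom P ts)
    then show ?thesis using less.prems assms(1) unfolding frame_over_def by blast
  next
    case (Conj B C)
    then have "B \<in> sentences L (node_dom N u)" "C \<in> sentences L (node_dom N u)"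
      using less.prems(2) by (auto simp: sentences_def)
    then show ?thesis using less.prems Conj less.hyps[of B u v] less.hyps[of C u v]
      by (auto simp: less_Suc_eq_le)
  next
    case (Disj B C)
    then have "B \<in> sentences L (node_dom N u)" "C \<in> sentences L (node_dom N u)"
      using less.prems(2) by (auto simp: sentences_def)
    then show ?thesis using less.prems Disj less.hyps[of B u v] less.hyps[of C u v]
      by (auto simp: less_Suc_eq_le)
  next
    case (Ex x B)
    then obtain d where d: "d \<in> node_dom N u" "forces N u (subst x d B)"
      using less.prems by auto
    have "subst x d B \<in> sentences L (node_dom N u)"
      using less.prems(2) Ex d(1) by (intro sentences_subst) (auto simp: sentences_def)
    then have "forces N v (subst x d B)" using less.hyps less.prems(1) d(2) Ex by simp
    moreover have "d \<in> node_dom N v"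
      using assms(1) less.prems(1) d(1) unfolding frame_over_def by blast
    ultimately show ?thesis using Ex by auto
  next
    case (Imp B C)
    then show ?thesis using less.prems(1,3) trans by (metis forces.simps(5))
  next
    case (All x B)
    then show ?thesis using less.prems(1,3) trans by (metis forces.simps(6))
  qed (use less.prems in simp)
qed

section \<open>Submodels, pruning and the Friedman translation\<close>

definition submodel :: "('k, 'f, 'p, 'd) kripke \<Rightarrow> 'k set \<Rightarrow> ('k, 'f, 'p, 'd) kripke" where
  "submodel M S = M\<lparr>nodes := S, le := le M \<inter> S \<times> S\<rparr>"

lemma submodel_sel [simp]:
  "nodes (submodel M S) = S" "le (submodel M S) = le M \<inter> S \<times> S" "str (submodel M S) = str M"
  by (auto simp: submodel_def)

lemma submodel_submodel: "T \<subseteq> S \<Longrightarrow> submodel (submodel M S) T = submodel M T"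
  by (auto simp: submodel_def intro!: kripke.equality)

lemma frame_over_submodel:
  assumes "frame_over L X N" "S \<subseteq> nodes N"
  shows "frame_over L X (submodel N S)"
proof -
  have "partial_order_on S (le N \<inter> S \<times> S)"
    using assms by (auto simp: frame_over_def partial_order_on_def preorder_on_def refl_on_def
        trans_def antisym_def; blast)
  then show ?thesis using assms by (auto simp: frame_over_def)
qed

text \<open>Forcing at a node looks only at nodes above it, so cutting down to an upper set changes
  nothing. This is applied to the cone above \<alpha>.\<close>

lemma forces_upset_submodel:
  assumes "\<And>u v. u \<in> S \<Longrightarrow> (u, v) \<in> le M \<Longrightarrow> v \<in> S" "u \<in> S"
  shows "forces (submodel M S) u A \<longleftrightarrow> forces M u A"
  using assms(2)
proof (induction "height A" arbitrary: A u rule: less_induct)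
  case less
  show ?case
  proof (cases A)
    case (Imp B C)
    then show ?thesis using less.hyps[of B] less.hyps[of C] assms(1) less.prems
      by (auto simp: less_Suc_eq_le)
  next
    case (All x B)
    then show ?thesis using less.hyps[of "subst x _ B"] assms(1) less.prems by auto
  next
    case (Ex x B)
    then show ?thesis using less.hyps[of "subst x _ B"] assms(1) less.prems by auto
  qed (use less in auto)
qed

definition prune :: "('k, 'f, 'p, 'd) kripke \<Rightarrow> ('f, 'p, 'd) fm \<Rightarrow> ('k, 'f, 'p, 'd) kripke" where
  "prune N B = submodel N {u \<in> nodes N. \<not> forces N u B}"

lemma prune_sel [simp]:
  "nodes (prune N B) = {u \<in> nodes N. \<not> forces N u B}"
  "le (prune N B) = le N \<inter> nodes (prune N B) \<times> nodes (prune N B)"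
  "str (prune N B) = str N"
  by (auto simp: prune_def)

lemma frame_over_prune: "frame_over L X N \<Longrightarrow> frame_over L X (prune N B)"
  unfolding prune_def by (rule frame_over_submodel) auto

text \<open>Where \<open>B\<close> is forced, every translated formula is forced, as every atom has
  gained the disjunct \<open>B\<close>. So implications and universal formulas are tested only at
  nodes that do not force \<open>B\<close>, and these are the nodes of
  \<open>prune N B\<close>.\<close>

lemma forces_friedman:
  assumes N: "frame_over L X N" and B: "B \<in> sentences L X" and "u \<in> nodes N"
  shows "forces N u (friedman B A) \<longleftrightarrow> forces N u B \<or> forces (prune N B) u A"
  using assms(3)
proof (induction "height A" arbitrary: A u rule: less_induct)
  case less
  have fv: "free_vars B = {}" using B by (simp add: sentences_def)
  have refl: "(u, u) \<in> le N" using frame_over_refl[OF N less.prems] .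
  have mono: "forces N v B" if "(u, v) \<in> le N" "forces N u B" for u v
  proof -
    have "u \<in> nodes N" using frame_over_le_nodes[OF N that(1)] by simp
    then have "B \<in> sentences L (node_dom N u)"
      using frame_over_sentence[OF N _ B] by blast
    then show ?thesis using forces_mono[OF N that(1)] that(2) by blast
  qed
  have nd: "v \<in> nodes N" if "(u, v) \<in> le N" for v using frame_over_le_nodes[OF N that] by simp
  have ne: "node_dom N u \<noteq> {}" using frame_over_dom_ne[OF N less.prems] .
  show ?case
  proof (cases A)
    case (Conj C D)
    then show ?thesis using less.hyps[of C u] less.hyps[of D u] less.prems by auto
  next
    case (Disj C D)
    then show ?thesis using less.hyps[of C u] less.hyps[of D u] less.prems by auto
  next
    case (Imp C D)
    have "forces N v (friedman B C) \<longleftrightarrow> forces N v B \<or> forces (prune N B) v C"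
      "forces N v (friedman B D) \<longleftrightarrow> forces N v B \<or> forces (prune N B) v D"
      if "(u, v) \<in> le N" for v
      using less.hyps[of C v] less.hyps[of D v] Imp nd[OF that] by auto
    then show ?thesis using Imp mono nd refl less.prems by auto
  next
    case (All x C)
    have "forces N v (friedman B (subst x d C)) \<longleftrightarrow>
        forces N v B \<or> forces (prune N B) v (subst x d C)" if "(u, v) \<in> le N" for v d
      using less.hyps[of "subst x d C" v] All nd[OF that] by auto
    then show ?thesis using All mono nd refl less.prems by (auto simp: subst_friedman[OF fv])
  next
    case (Ex x C)
    have "forces N u (friedman B (subst x d C)) \<longleftrightarrow>
        forces N u B \<or> forces (prune N B) u (subst x d C)" for d
      using less.hyps[of "subst x d C" u] Ex less.prems by auto
    \<comment> \<open>If \<open>u\<close> forces \<open>B\<close>, the existential formula still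
      needs a witness; the nonempty domain supplies one.\<close>
    then show ?thesis using Ex ne by (auto simp: subst_friedman[OF fv])
  qed auto
qed

text \<open>This is why iterated translations code iterated prunings: the sentence used first is the
  one by which the other is translated.\<close>

lemma prune_prune:
  assumes "frame_over L X N" "B \<in> sentences L X"
  shows "prune (prune N B) \<rho> = prune N (friedman B \<rho>)"
proof -
  have "{u \<in> nodes (prune N B). \<not> forces (prune N B) u \<rho>} = {u \<in> nodes N. \<not> forces N u (friedman B \<rho>)}"
    using forces_friedman[OF assms] by auto
  moreover have "prune (prune N B) \<rho> = submodel N {u \<in> nodes (prune N B). \<not> forces (prune N B) u \<rho>}"
    unfolding prune_def[of "prune N B"] unfolding prune_def[of N] by (rule submodel_submodel) auto
  ultimately show ?thesis by (simp add: prune_def)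
qed

lemma prune_Bot: "frame_over L X N \<Longrightarrow> prune N Bot = N"
  using frame_over_le_nodes[of L X N] by (auto intro!: kripke.equality)

text \<open>\<open>friedman_pow\<close> adds its new sentence as the first pruning, whereas the
  process appends one at the end. The induction therefore varies \<open>N\<close>: the first pruning
  is split off, the hypothesis is used in the model it leaves, and the sentence is put back.\<close>

lemma prune_friedman_pow_Suc:
  assumes "frame_over L X N" "\<Gamma> \<subseteq> sentences L X" "\<rho> \<in> friedman_pow \<Gamma> n" "B \<in> \<Gamma>"
  shows "\<exists>\<rho>' \<in> friedman_pow \<Gamma> (Suc n). prune (prune N \<rho>) B = prune N \<rho>'"
  using assms(1,3)
proof (induction n arbitrary: N \<rho>)
  case 0
  then have "\<rho> = Bot" by simp
  \<comment> \<open>A single pruning by \<open>B\<close> is coded by \<open>friedman B Bot\<close>,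
    the form of the members of the first power of \<Gamma>; the extra pruning by \<open>Bot\<close>
    removes nothing.\<close>
  have "prune (prune N B) Bot = prune N (friedman B Bot)" using prune_prune 0 assms by blast
  moreover have "prune (prune N B) Bot = prune N B" using prune_Bot frame_over_prune[OF 0(1)] by blast
  ultimately have "prune (prune N \<rho>) B = prune N (friedman B Bot)"
    using prune_Bot[OF 0(1)] \<open>\<rho> = Bot\<close> by simp
  then show ?case using assms(4) by auto
next
  case (Suc n)
  then obtain A C where AC: "\<rho> = friedman C A" "A \<in> friedman_pow \<Gamma> n" "C \<in> \<Gamma>" by auto
  then have C: "C \<in> sentences L X" using assms(2) by blast
  obtain A' where A': "A' \<in> friedman_pow \<Gamma> (Suc n)" "prune (prune (prune N C) A) B = prune (prune N C) A'"
    using Suc.IH[OF frame_over_prune[OF Suc.prems(1)] AC(2)] by blast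
  have "prune (prune N \<rho>) B = prune N (friedman C A')"
    using A'(2) AC(1) prune_prune[OF Suc.prems(1) C] by simp
  moreover have "friedman C A' \<in> friedman_pow \<Gamma> (Suc (Suc n))"
    using A'(1) AC(3) by (subst friedman_pow.simps) blast
  ultimately show ?case by blast
qed

section \<open>Forcing and classical truth at a deciding node\<close>

text \<open>The universal step needs \<open>u\<close> to decide \<open>\<exists>x. \<not> B\<^sup>\<forall>\<close>: the elements of the domain of \<open>u\<close>
  leave only \<open>\<not> (\<exists>x. \<not> B\<^sup>\<forall>)\<close>, that is \<open>\<forall>x. \<not> \<not> B\<^sup>\<forall>\<close>, which also speaks about later elements.\<close>

lemma forces_forall_trans_iff_satisfies:
  assumes N: "frame_over L X N" and u: "u \<in> nodes N"
    and dec: "\<And>A. A \<in> sentences L (node_dom N u) \<Longrightarrow> forces N u (Disj A (Neg A))"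
    and "A \<in> sentences L (node_dom N u)"
  shows "forces N u (forall_trans A) \<longleftrightarrow> satisfies (str N u) A"
  using assms(4)
proof (induction "height A" arbitrary: A rule: less_induct)
  case less
  note mono = forces_mono[OF N]
  have refl: "(u, u) \<in> le N" using frame_over_refl[OF N u] .
  show ?case
  proof (cases A)
    case (Conj B C)
    then have "B \<in> sentences L (node_dom N u)" "C \<in> sentences L (node_dom N u)"
      using less.prems by (auto simp: sentences_def)
    then show ?thesis using Conj less.hyps[of B] less.hyps[of C] by auto
  next
    case (Disj B C)
    then have "B \<in> sentences L (node_dom N u)" "C \<in> sentences L (node_dom N u)"
      using less.prems by (auto simp: sentences_def)
    then show ?thesis using Disj less.hyps[of B] less.hyps[of C] by auto
  next
    case (Imp B C)
    then have s: "B \<in> sentences L (node_dom N u)" "C \<in> sentences L (node_dom N u)"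
      using less.prems by (auto simp: sentences_def)
    then have IH: "forces N u (forall_trans B) \<longleftrightarrow> satisfies (str N u) B"
      "forces N u (forall_trans C) \<longleftrightarrow> satisfies (str N u) C"
      using Imp less.hyps[of B] less.hyps[of C] by auto
    \<comment> \<open>If \<open>u\<close> forces the premise, it forces the conclusion, which
      persists; otherwise it forces the negation of the premise, and no node above forces the
      premise.\<close>
    have "forces N u (Imp (forall_trans B) (forall_trans C)) \<longleftrightarrow>
        (forces N u (forall_trans B) \<longrightarrow> forces N u (forall_trans C))"
      using dec[OF forall_trans_sentence[OF s(1)]] refl
        mono[OF _ forall_trans_sentence[OF s(2)]] by auto
    then show ?thesis using Imp IH by simp
  next
    case (All x B)
    let ?B = "forall_trans B"
    have s: "subst x d B \<in> sentences L (node_dom N u)" if "d \<in> node_dom N u" for d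
      using less.prems All that by (intro sentences_subst) (auto simp: sentences_def)
    have IH: "forces N u (subst x d ?B) \<longleftrightarrow> satisfies (str N u) (subst x d B)"
      if "d \<in> node_dom N u" for d
      using less.hyps[OF _ s[OF that]] All by simp
    have "Ex x (Neg ?B) \<in> sentences L (node_dom N u)"
      using less.prems All by (auto simp: sentences_def)
    from dec[OF this] have ex: "forces N u (Ex x (Neg ?B)) \<or> forces N u (Neg (Ex x (Neg ?B)))"
      by (simp only: forces.simps)
    have "forces N u (All x (Neg (Neg ?B))) \<longleftrightarrow> (\<forall>d \<in> node_dom N u. forces N u (subst x d ?B))"
    proof
      assume *: "forces N u (All x (Neg (Neg ?B)))"
      show "\<forall>d \<in> node_dom N u. forces N u (subst x d ?B)"
      proof
        fix d assume d: "d \<in> node_dom N u"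
        have "forces N u (Neg (Neg (subst x d ?B)))" using * d refl by simp
        moreover have "forces N u (Disj (subst x d ?B) (Neg (subst x d ?B)))"
          using dec[OF forall_trans_sentence[OF s[OF d]]] by simp
        ultimately show "forces N u (subst x d ?B)" using refl by auto
      qed
    next
      assume *: "\<forall>d \<in> node_dom N u. forces N u (subst x d ?B)"
      then have "\<not> forces N u (Ex x (Neg ?B))" using refl by auto
      then have "forces N u (Neg (Ex x (Neg ?B)))" using ex by blast
      \<comment> \<open>A later node that forces the negation at an element \<open>d\<close> of an
        earlier domain still has \<open>d\<close> in its own domain, so it would force
        \<open>Ex x (Neg ?B)\<close>.\<close>
      then show "forces N u (All x (Neg (Neg ?B)))"
        using frame_over_trans[OF N] N unfolding frame_over_def by simp blast
    qed
    then show ?thesis using All IH by simp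
  next
    case (Ex x B)
    have "subst x d B \<in> sentences L (node_dom N u)" if "d \<in> node_dom N u" for d
      using less.prems Ex that by (intro sentences_subst) (auto simp: sentences_def)
    then show ?thesis using Ex less.hyps[of "subst x _ B"] by simp
  qed auto
qed

section \<open>Ranks, depth and termination of pruning\<close>

text \<open>Following \<open>up\<close> from \<open>S k\<close> to \<open>S 0\<close> visits one
  node at each of \<open>k + 1\<close> levels; these form a chain above \<open>u\<close>.\<close>

lemma depth_ge_rank:
  assumes po: "partial_order_on (nodes M) (le M)" and S: "\<And>n. S n \<subseteq> nodes M"
    and up: "\<And>n u. u \<in> S (Suc n) \<Longrightarrow> \<exists>v \<in> S n - S (Suc n). (u, v) \<in> le M"
    and "u \<in> S k"
  shows "enat (Suc k) \<le> depth M u"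
proof -
  have refl: "(u, u) \<in> le M" if "u \<in> S n" for n u
    using po S that by (auto simp: partial_order_on_def preorder_on_def refl_on_def)
  have trans: "trans (le M)" and anti: "antisym (le M)"
    using po by (auto simp: partial_order_on_def preorder_on_def)
  have "\<exists>C. C \<in> Chains (le M) \<and> finite C \<and> C \<subseteq> above (le M) u \<and> card C = Suc k"
    using assms(4)
  proof (induction k arbitrary: u)
    case 0
    then show ?case using refl by (intro exI[of _ "{u}"]) (auto simp: Chains_def above_def)
  next
    case (Suc k)
    obtain v where v: "v \<in> S k" "v \<notin> S (Suc k)" "(u, v) \<in> le M" using up[OF Suc.prems] by blast
    obtain C where C: "C \<in> Chains (le M)" "finite C" "C \<subseteq> above (le M) v" "card C = Suc k"
      using Suc.IH[OF v(1)] by blast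
    have uC: "(u, w) \<in> le M" if "w \<in> C" for w
      using C(3) v(3) that trans by (auto simp: above_def elim: transE)
    \<comment> \<open>Otherwise \<open>u\<close> and \<open>v\<close> would lie below each other and
      coincide, but only \<open>u\<close> is in \<open>S (Suc k)\<close>.\<close>
    have "u \<notin> C"
    proof
      assume "u \<in> C"
      then have "(v, u) \<in> le M" using C(3) by (auto simp: above_def)
      then have "u = v" using v(3) anti by (auto dest: antisymD)
      then show False using v(2) Suc.prems by simp
    qed
    then show ?case using C uC refl[OF Suc.prems]
      by (intro exI[of _ "insert u C"]) (auto simp: Chains_def above_def)
  qed
  then obtain C where "C \<in> Chains (le M)" "finite C" "C \<subseteq> above (le M) u" "card C = Suc k" by blast
  then show ?thesis unfolding depth_def by (intro SUP_upper2[of C]) auto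
qed

text \<open>The strict predecessors of \<open>v\<close> are well-ordered: take the least one in
  \<open>T\<close>, or \<open>v\<close> itself if none is in \<open>T\<close>. It is minimal in all
  of \<open>T\<close>, as whatever lies strictly below it is a strict predecessor of
  \<open>v\<close> too.\<close>

lemma tree_frame_minimal:
  assumes "kripke_model L M" "tree_frame M" "v \<in> T" "T \<subseteq> nodes M"
  obtains m where "m \<in> T" "(m, v) \<in> le M" "\<And>w. w \<in> T \<Longrightarrow> (w, m) \<in> le M \<Longrightarrow> w = m"
proof -
  have po: "partial_order_on (nodes M) (le M)" using assms(1) by (simp add: kripke_model_def)
  then have refl: "(v, v) \<in> le M" using assms(3,4)
    by (auto simp: partial_order_on_def preorder_on_def refl_on_def)
  show thesis
  proof (cases "T \<inter> underS (le M) v = {}")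
    case True
    then have "w = v" if "w \<in> T" "(w, v) \<in> le M" for w using that by (auto simp: underS_def)
    then show ?thesis using that[of v] refl assms(3) by blast
  next
    case False
    let ?U = "underS (le M) v"
    let ?R = "Restr (le M) ?U"
    have "wf (?R - Id)" using assms(2-4) unfolding tree_frame_def well_order_on_def by blast
    moreover obtain x where "x \<in> T \<inter> ?U" using False by blast
    ultimately obtain m where m: "m \<in> T \<inter> ?U" "\<And>w. (w, m) \<in> ?R - Id \<Longrightarrow> w \<notin> T \<inter> ?U"
      by (metis wfE_min)
    have trans: "trans (le M)" and anti: "antisym (le M)"
      using po by (auto simp: partial_order_on_def preorder_on_def)
    have "w = m" if "w \<in> T" "(w, m) \<in> le M" for w
    proof (rule ccontr)
      assume "w \<noteq> m"
      have "(m, v) \<in> le M" "m \<noteq> v" using m(1) by (auto simp: underS_def)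
      then have "(w, v) \<in> le M" "w \<noteq> v" using that(2) trans anti
        by (auto elim: transE dest: antisymD)
      then show False using m that \<open>w \<noteq> m\<close> by (auto simp: underS_def)
    qed
    then show ?thesis using that[of m] m(1) by (auto simp: underS_def)
  qed
qed

text \<open>Give a node outside \<open>\<Inter>n. S n\<close> the rank \<open>k\<close> if it leaves the sequence at step \<open>Suc k\<close>. The minimal
  nodes outside the intersection form an antichain, and depth bounds rank, so their ranks are bounded;
  hence so are all ranks, although nodes of every rank lie above \<open>\<alpha>\<close>.\<close>

lemma no_infinite_pruning:
  assumes M: "kripke_model L M" "tree_frame M" "semi_narrow M"
    and S: "S 0 \<subseteq> nodes M" "\<And>n. S (Suc n) \<subseteq> S n"
    and up: "\<And>n u. u \<in> S (Suc n) \<Longrightarrow> \<exists>v \<in> S n - S (Suc n). (u, v) \<in> le M"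
    and down: "\<And>n u v. u \<in> S 0 \<Longrightarrow> v \<in> S n \<Longrightarrow> (u, v) \<in> le M \<Longrightarrow> u \<in> S n"
    and \<alpha>: "\<And>n. \<alpha> \<in> S n"
  shows False
proof -
  have po: "partial_order_on (nodes M) (le M)" using M(1) by (simp add: kripke_model_def)
  have anti_mono: "S n \<subseteq> S m" if "m \<le> n" for m n using lift_Suc_antimono_le[of S] S(2) that by blast
  have sub: "S n \<subseteq> nodes M" for n using anti_mono[of 0 n] S(1) by auto
  define T where "T = S 0 - (\<Inter>n. S n)"
  define X where "X = {m \<in> T. \<forall>w \<in> T. (w, m) \<in> le M \<longrightarrow> w = m}"
  have T: "T \<subseteq> nodes M" using S(1) by (auto simp: T_def)
  have "X \<subseteq> nodes M" using T by (auto simp: X_def)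
  moreover have "pairwise (\<lambda>u v. (u, v) \<notin> le M \<and> (v, u) \<notin> le M) X"
    by (auto simp: pairwise_def X_def)
  ultimately obtain n where n: "finite {u \<in> X. \<not> depth M u \<le> enat n}"
    using M(3) unfolding semi_narrow_def by blast
  have "\<forall>u \<in> T. \<exists>k. u \<notin> S k" by (auto simp: T_def)
  \<comment> \<open>\<open>r u\<close> is some stage at which \<open>u\<close> is gone, not
    necessarily the first.\<close>
  then obtain r where r: "\<And>u. u \<in> T \<Longrightarrow> u \<notin> S (r u)" by metis
  have "finite (r ` {u \<in> X. \<not> depth M u \<le> enat n})" using n by simp
  then obtain b where b: "\<And>u. u \<in> X \<Longrightarrow> \<not> depth M u \<le> enat n \<Longrightarrow> r u \<le> b"
    by (auto simp: finite_nat_set_iff_bounded_le)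
  \<comment> \<open>\<open>n\<close> serves the minimal nodes of depth at most \<open>n\<close>, and
    \<open>b\<close> the finitely many others.\<close>
  define K where "K = max n b"
  have XK: "u \<notin> S K" if u: "u \<in> X" for u
  proof (cases "depth M u \<le> enat n")
    case True
    show ?thesis
    proof
      assume "u \<in> S K"
      then have "enat (Suc K) \<le> depth M u" using depth_ge_rank[of M S, OF po sub up] by blast
      then have "enat (Suc K) \<le> enat n" using True by (rule order_trans)
      then show False by (simp add: K_def)
    qed
  next
    case False
    then have "r u \<le> K" using b[OF u] by (simp add: K_def)
    then show ?thesis using r[of u] u anti_mono by (auto simp: X_def)
  qed
  \<comment> \<open>As \<alpha> is never removed, it sees a node that leaves exactly at step
    \<open>Suc K\<close>. A minimal node below that one is, by \<open>down\<close>, still in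
    \<open>S K\<close>.\<close>
  obtain v where v: "v \<in> S K" "v \<notin> S (Suc K)" using up[OF \<alpha>] by blast
  then have "v \<in> T" using anti_mono[of 0 K] by (auto simp: T_def)
  then obtain m where m: "m \<in> T" "(m, v) \<in> le M" "\<And>w. w \<in> T \<Longrightarrow> (w, m) \<in> le M \<Longrightarrow> w = m"
    using tree_frame_minimal[OF M(1,2) _ T] by blast
  then have "m \<in> X" "m \<in> S 0" by (auto simp: X_def T_def)
  then show False using XK down v(1) m(2) by blast
qed

section \<open>The pruning sequence and the theorem\<close>

text \<open>A survivor does not force \<open>Neg A\<close>, so it sees a node forcing
  \<open>A\<close>; that node forces the disjunction and is removed.\<close>

lemma prune_PEM_exits:
  assumes N: "frame_over L X N" and B: "B \<in> PEM_sen L X" and u: "u \<in> nodes (prune N B)"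
  shows "\<exists>v \<in> nodes N - nodes (prune N B). (u, v) \<in> le N"
proof -
  obtain A where A: "B = Disj A (Neg A)" using B by (auto simp: PEM_sen_def)
  then obtain v where v: "(u, v) \<in> le N" "forces N v A" using u by auto
  then show ?thesis using frame_over_le_nodes[OF N v(1)] A by auto
qed

theorem mainTheorem4:
  fixes L :: "('f, 'p) lang"
    and M :: "('k, 'f, 'p, 'd) kripke"
    and \<alpha> :: 'k
  assumes "kripke_model L M"
    and "tree_frame M"
    and "semi_narrow M"
    and "\<alpha> \<in> nodes M"
  shows "\<exists>\<rho> \<in> friedman_star (PEM_sen L (node_dom M \<alpha>)).
    \<forall>A \<in> sentences L (node_dom M \<alpha>).
      forces M \<alpha> (friedman \<rho> (forall_trans A)) \<longleftrightarrow> satisfies (str M \<alpha>) A"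
proof -
  define X where "X = node_dom M \<alpha>"
  let ?\<Gamma> = "PEM_sen L X"
  have \<Gamma>: "?\<Gamma> \<subseteq> sentences L X" by (rule PEM_sen_sentences)
  have po: "partial_order_on (nodes M) (le M)" using assms(1) by (simp add: kripke_model_def)
  then have trans: "trans (le M)" and refl: "(\<alpha>, \<alpha>) \<in> le M"
    and lesub: "le M \<subseteq> nodes M \<times> nodes M"
    using assms(4) by (auto simp: partial_order_on_def preorder_on_def refl_on_def)
  \<comment> \<open>In the cone above \<alpha> every domain contains \<open>X\<close>, so the
    members of \<Gamma> are sentences over the domain of each of its nodes.\<close>
  define U where "U = {u. (\<alpha>, u) \<in> le M}"
  have U: "U \<subseteq> nodes M" using lesub by (auto simp: U_def)
  define C where "C = submodel M U"
  have "frame_over L {} M" using assms(1) by (auto simp: kripke_model_def frame_over_def)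
  then have "frame_over L {} C" unfolding C_def using U by (rule frame_over_submodel)
  moreover have "X \<subseteq> node_dom C u" if "u \<in> nodes C" for u
    using that assms(1) unfolding kripke_model_def C_def X_def U_def by simp
  ultimately have C: "frame_over L X C" by (simp add: frame_over_def)
  have "\<exists>\<rho> \<in> friedman_star ?\<Gamma>. \<alpha> \<in> nodes (prune C \<rho>) \<and> (\<forall>B \<in> ?\<Gamma>. forces (prune C \<rho>) \<alpha> B)"
  proof (rule ccontr)
    assume neg: "\<not> ?thesis"
    \<comment> \<open>Coded prunings of the cone that keep \<alpha>; by \<open>neg\<close>, none of
      them forces all of \<Gamma> at \<alpha>.\<close>
    define good where "good N \<longleftrightarrow> (\<exists>\<rho> \<in> friedman_star ?\<Gamma>. N = prune C \<rho>) \<and> \<alpha> \<in> nodes N" for N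
    have "good C"
      unfolding good_def
    proof (intro conjI bexI)
      show "C = prune C Bot" using prune_Bot[OF C] by simp
      show "Bot \<in> friedman_star ?\<Gamma>" unfolding friedman_star_def by (rule UN_I[of 0]) auto
      show "\<alpha> \<in> nodes C" using refl by (simp add: C_def U_def)
    qed
    moreover have "\<exists>N'. good N' \<and> (\<exists>B \<in> ?\<Gamma>. N' = prune N B)" if N: "good N" for N
    proof -
      obtain \<rho> n where \<rho>: "\<rho> \<in> friedman_pow ?\<Gamma> n" "N = prune C \<rho>" "\<alpha> \<in> nodes N"
        using N unfolding good_def friedman_star_def by blast
      \<comment> \<open>Pruning by a sentence that \<alpha> does not force keeps \<alpha>.\<close>
      then obtain B where B: "B \<in> ?\<Gamma>" "\<not> forces N \<alpha> B"
        using neg by (auto simp: friedman_star_def)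
      obtain \<rho>' where \<rho>': "\<rho>' \<in> friedman_pow ?\<Gamma> (Suc n)" "prune N B = prune C \<rho>'"
        using prune_friedman_pow_Suc[OF C \<Gamma> \<rho>(1) B(1)] \<rho>(2) by blast
      have "\<alpha> \<in> nodes (prune N B)" using \<rho>(3) B(2) by simp
      moreover have "\<rho>' \<in> friedman_star ?\<Gamma>" using \<rho>'(1) unfolding friedman_star_def by blast
      ultimately have "good (prune N B)" using \<rho>'(2) unfolding good_def by blast
      then show ?thesis using B(1) by blast
    qed
    \<comment> \<open>Dependent choice; the clause for \<open>n = 0\<close> makes the sequence start
      at \<open>C\<close>.\<close>
    ultimately obtain N where N0: "N 0 = C" and good: "\<And>n. good (N n)"
      and step: "\<And>n. \<exists>B \<in> ?\<Gamma>. N (Suc n) = prune (N n) B"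
      using dependent_nat_choice[of "\<lambda>n N. good N \<and> (n = 0 \<longrightarrow> N = C)"
          "\<lambda>n N N'. \<exists>B \<in> ?\<Gamma>. N' = prune N B"] by (metis nat.distinct(1))
    have frame: "frame_over L X (N n)" for n
      using good[of n] frame_over_prune[OF C] by (auto simp: good_def)
    have leN: "le (N n) = le M \<inter> nodes (N n) \<times> nodes (N n)" for n
      using good[of n] by (auto simp: good_def C_def)
    show False
    proof (rule no_infinite_pruning[OF assms(1-3), where S = "\<lambda>n. nodes (N n)" and \<alpha> = \<alpha>])
      show "nodes (N 0) \<subseteq> nodes M" using U by (simp add: N0 C_def)
      show "nodes (N (Suc n)) \<subseteq> nodes (N n)" for n using step[of n] by auto
      show "\<exists>v \<in> nodes (N n) - nodes (N (Suc n)). (u, v) \<in> le M" if "u \<in> nodes (N (Suc n))" for n u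
        using step[of n] prune_PEM_exits[OF frame[of n]] that leN[of n] by fastforce
      show "\<alpha> \<in> nodes (N n)" for n using good by (simp add: good_def)
      \<comment> \<open>Survival passes downward: if \<open>u\<close> forced the sentence
        \<open>B\<close> of some step, so would \<open>v\<close>.\<close>
      show "u \<in> nodes (N n)" if "u \<in> nodes (N 0)" "v \<in> nodes (N n)" "(u, v) \<in> le M" for n u v
        using that(2)
      proof (induction n)
        case 0
        show ?case by (rule that(1))
      next
        case (Suc n)
        obtain B where B: "B \<in> ?\<Gamma>" "N (Suc n) = prune (N n) B" using step by blast
        then have v: "v \<in> nodes (N n)" "\<not> forces (N n) v B" using Suc.prems by auto
        then have u: "u \<in> nodes (N n)" using Suc.IH by blast
        then have "(u, v) \<in> le (N n)" using leN v(1) that(3) by auto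
        moreover have "B \<in> sentences L (node_dom (N n) u)"
          using frame_over_sentence[OF frame u] B(1) \<Gamma> by blast
        ultimately have "\<not> forces (N n) u B" using forces_mono[OF frame] v(2) by blast
        then show ?case using u B(2) by simp
      qed
    qed
  qed
  then obtain \<rho> where \<rho>: "\<rho> \<in> friedman_star ?\<Gamma>" "\<alpha> \<in> nodes (prune C \<rho>)"
    "\<And>B. B \<in> ?\<Gamma> \<Longrightarrow> forces (prune C \<rho>) \<alpha> B" by blast
  have \<rho>s: "\<rho> \<in> sentences L X"
    using \<rho>(1) friedman_pow_sentences[OF _ \<Gamma>] by (auto simp: friedman_star_def)
  have str: "str (prune C \<rho>) = str M" by (simp add: C_def)
  have "forces M \<alpha> (friedman \<rho> (forall_trans A)) \<longleftrightarrow> satisfies (str M \<alpha>) A"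
    if A: "A \<in> sentences L X" for A
  proof -
    \<comment> \<open>The cone is an upper set, so forcing agrees there. Since \<alpha> survives, it
      does not force \<rho>, and \<open>forces_friedman\<close> reduces to forcing in the pruned
      model.\<close>
    have "\<alpha> \<in> U" using refl by (simp add: U_def)
    then have "forces M \<alpha> (friedman \<rho> (forall_trans A)) \<longleftrightarrow>
        forces C \<alpha> (friedman \<rho> (forall_trans A))"
      unfolding C_def using trans
      by (intro forces_upset_submodel[symmetric]) (auto simp: U_def elim: transE)
    also have "\<dots> \<longleftrightarrow> forces (prune C \<rho>) \<alpha> (forall_trans A)"
      using forces_friedman[OF C \<rho>s] \<rho>(2) by simp
    also have "\<dots> \<longleftrightarrow> satisfies (str (prune C \<rho>) \<alpha>) A"
    proof (rule forces_forall_trans_iff_satisfies[OF frame_over_prune[OF C] \<rho>(2)])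
      \<comment> \<open>\<Gamma> contains excluded middle for every sentence over the domain of
        \<alpha>, and pruning leaves that domain as it is.\<close>
      show "forces (prune C \<rho>) \<alpha> (Disj A' (Neg A'))"
        if "A' \<in> sentences L (node_dom (prune C \<rho>) \<alpha>)" for A'
        using that \<rho>(3)[of "Disj A' (Neg A')"] unfolding str X_def PEM_sen_def by blast
      show "A \<in> sentences L (node_dom (prune C \<rho>) \<alpha>)" using A unfolding str X_def .
    qed
    finally show ?thesis unfolding str .
  qed
  then show ?thesis using \<rho>(1) unfolding X_def by blast
qed

end
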